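(* Let $\{(x_n,\lambda_n,c_n)\}$ be a sequence generated by the inexact basic augmented Lagrangian method with tolerances $\{\varepsilon_n\}$, and put $\varepsilon_*=\limsup_{n\to\infty}\varepsilon_n$. Suppose that the sequence $\{f(x_n)\}$ is bounded below and the following two assumptions hold: (i) if $c_n\to+\infty$ as $n\to\infty$, then $\lim_{n\to\infty}\|\lambda_n\|/\sqrt{c_n}=0$; (ii) if the sequence $\{c_n\}$ is bounded, then (a) the sequence $\{\lambda_n\}$ is bounded, (b) the sequence $\sigma_n:=(1/c_n)\|\Pi_{K^*}(\lambda_n+c_nG(x_n))-\lambda_n\|$, $n\in\mathbb{N}$, converges to zero, and (c) either the sequence $\{\Pi_K(G(x_n))\}$ is bounded or $Y=\mathbb{R}^{m+\ell}$ and $K=\{0\}\times\mathbb{R}^\ell_-$, where $0\in\mathbb{R}^m$ and $\mathbb{R}_-=(-\infty,0]$. Then \[ \lim_{n\to\infty}\operatorname{dist}(G(x_n),K)=0,\qquad \limsup_{n\to\infty}\varphi(x_n,(\lambda_n,c_n))\le\varepsilon_*, \] \[ \vartheta_*\le\liminf_{n\to\infty}f(x_n)\le\limsup_{n\to\infty}f(x_n)\le\vartheta_*+\varepsilon_*, \] \[ \vartheta_*-\varepsilon_*\le\liminf_{n\to\infty}\Theta(\lambda_n,c_n)\le\limsup_{n\to\infty}\Theta(\lambda_n,c_n)\le\vartheta_*, \] where $\vartheta_*:=\min\{f_*,\liminf_{y\to0}\beta(y)\}$. If, in addition, the optimal value function $\beta$ is lower semicontinuous at the origin, then $\vartheta_*=f_*$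 and the following statements hold: (1) if $f$ is lower semicontinuous on $Q$ and $G$ is continuous on $Q$, then any limit point of $\{x_n\}$ (if such a point exists) is an $\varepsilon_*$-optimal solution of the problem of minimizing $f(x)$ subject to $G(x)\in K$, $x\in Q$; (2) if the sequence of penalty parameters $\{c_n\}$ is bounded, then any limit point of the sequence $\{(\lambda_n,c_n)\}$ (if such a point exists) is an $\varepsilon_*$-optimal solution of the dual problem.
   Context: Setting. $(X,d_X)$ is a metric space, $Q\subset X$ is nonempty and closed, $f\colon X\to\mathbb{R}\cup\{+\infty\}$, $Y$ is a (real) Hilbert space with inner product $\langle\cdot,\cdot\rangle$, $K\subset Y$ is a closed convex cone, and $G\colon X\to Y$. The problem is: minimize $f(x)$ subject to $G(x)\in K$, $x\in Q$. Its feasible region is assumed nonempty and its optimal value $f_*$ is assumed finite. The optimal value function is $\beta(y)=\inf\{f(x)\mid x\in Q,\ G(x)-y\in K\}$, $y\in Y$ ($\inf\emptyset=+\infty$), so $\beta(0)=f_*$; lower semicontinuity at the origin means $\beta(0)\le\liminf_{y\to0}\beta(y)$. $K^*=\{y^*\in Y\mid\langle y^*,y\rangle\le0\ \forall y\in K\}$ is the polar cone, and $\Pi_V(y)$ is the metric projection of $y\in Y$ onto a closed convex set $V\subseteq Y$. $\operatorname{dist}(y,K)$ is the distance from $y$ to $K$. For $x\in X$, $\lambda\in Y$, $c>0$, \[\varphi(x,(\lambda,c))=\frac1{2c}\Big[\|\Pi_{K^*}(\lambda+cG(x))\|^2-\|\lambda\|^2\Big]=\frac1{2c}\Big[\operatorname{dist}(\lambda+cG(x),K)^2-\|\lambda\|^2\Big],\]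 and the augmented Lagrangian is $\mathscr{L}(x,\lambda,c)=f(x)+\varphi(x,(\lambda,c))$. The dual function is $\Theta(\lambda,c)=\inf_{x\in Q}\mathscr{L}(x,\lambda,c)$, and the dual problem is to maximize $\Theta$ over $M=Y\times(0,+\infty)$, with optimal value $\Theta_*$. Inexact basic augmented Lagrangian method: choose $\lambda_0\in K^*$, $c_0>0$, and a bounded above sequence $\{\varepsilon_n\}\subset[0,+\infty)$. For each $n=0,1,2,\dots$: $x_n\in Q$ satisfies $\mathscr{L}(x_n,\lambda_n,c_n)\le\mathscr{L}(x,\lambda_n,c_n)+\varepsilon_n$ for all $x\in Q$; choose some $\lambda_{n+1}\in K^*$ and some $c_{n+1}\ge c_n$ (both arbitrary). Standing assumption: for every $n$ the function $\mathscr{L}(\cdot,\lambda_n,c_n)$ is bounded below on $Q$. A limit point of a sequence is the limit of some convergent subsequence. For $\varepsilon\ge0$, an $\varepsilon$-optimal solution of the constrained problem is a feasible $x$ with $f(x)\le f_*+\varepsilon$; an $\varepsilon$-optimal solution of the dual problem is $(\lambda,c)\in M$ with $\Theta(\lambda,c)\ge\Theta_*-\varepsilon$. *)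

theory Defs
  imports "HOL-Analysis.Analysis"
begin

definition polar_cone :: "'b::real_inner set \<Rightarrow> 'b set" where
  "polar_cone K = {s. \<forall>y\<in>K. s \<bullet> y \<le> 0}"

(* closest_point has the same definition, but its type requires a Heine-Borel space, which a
   general Hilbert space is not. *)
definition metric_proj :: "'b::real_normed_vector set \<Rightarrow> 'b \<Rightarrow> 'b" where
  "metric_proj V y = (SOME z. z \<in> V \<and> (\<forall>v\<in>V. dist y z \<le> dist y v))"

definition feasible_set :: "('a \<Rightarrow> 'b) \<Rightarrow> 'b set \<Rightarrow> 'a set \<Rightarrow> 'a set" where
  "feasible_set G K Q = {x\<in>Q. G x \<in> K}"

definition opt_value :: "('a \<Rightarrow> ereal) \<Rightarrow> ('a \<Rightarrow> 'b) \<Rightarrow> 'b set \<Rightarrow> 'a set \<Rightarrow> ereal" where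
  "opt_value f G K Q = (INF x\<in>feasible_set G K Q. f x)"

definition opt_value_fun ::
    "('a \<Rightarrow> ereal) \<Rightarrow> ('a \<Rightarrow> 'b::real_vector) \<Rightarrow> 'b set \<Rightarrow> 'a set \<Rightarrow> 'b \<Rightarrow> ereal" where
  "opt_value_fun f G K Q y = (INF x\<in>{x\<in>Q. G x - y \<in> K}. f x)"

definition aug_term ::
    "('a \<Rightarrow> 'b::real_inner) \<Rightarrow> 'b set \<Rightarrow> 'a \<Rightarrow> 'b \<Rightarrow> real \<Rightarrow> real" where
  "aug_term G K x l c =
     1 / (2 * c) * ((norm (metric_proj (polar_cone K) (l + c *\<^sub>R G x)))\<^sup>2 - (norm l)\<^sup>2)"

definition aug_lagrangian ::
    "('a \<Rightarrow> ereal) \<Rightarrow> ('a \<Rightarrow> 'b::real_inner) \<Rightarrow> 'b set \<Rightarrow> 'a \<Rightarrow> 'b \<Rightarrow> real \<Rightarrow> ereal" where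
  "aug_lagrangian f G K x l c = f x + ereal (aug_term G K x l c)"

definition dual_fun ::
    "('a \<Rightarrow> ereal) \<Rightarrow> ('a \<Rightarrow> 'b::real_inner) \<Rightarrow> 'b set \<Rightarrow> 'a set \<Rightarrow> 'b \<Rightarrow> real \<Rightarrow> ereal" where
  "dual_fun f G K Q l c = (INF x\<in>Q. aug_lagrangian f G K x l c)"

definition dual_domain :: "('b \<times> real) set" where
  "dual_domain = UNIV \<times> {0<..}"

definition dual_opt_value ::
    "('a \<Rightarrow> ereal) \<Rightarrow> ('a \<Rightarrow> 'b::real_inner) \<Rightarrow> 'b set \<Rightarrow> 'a set \<Rightarrow> ereal" where
  "dual_opt_value f G K Q = (SUP (l, c)\<in>dual_domain. dual_fun f G K Q l c)"

definition eps_optimal ::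
    "('a \<Rightarrow> ereal) \<Rightarrow> ('a \<Rightarrow> 'b) \<Rightarrow> 'b set \<Rightarrow> 'a set \<Rightarrow> ereal \<Rightarrow> 'a \<Rightarrow> bool" where
  "eps_optimal f G K Q e x \<longleftrightarrow> x \<in> feasible_set G K Q \<and> f x \<le> opt_value f G K Q + e"

definition dual_eps_optimal ::
    "('a \<Rightarrow> ereal) \<Rightarrow> ('a \<Rightarrow> 'b::real_inner) \<Rightarrow> 'b set \<Rightarrow> 'a set \<Rightarrow> ereal \<Rightarrow> 'b \<times> real \<Rightarrow> bool"
  where
  "dual_eps_optimal f G K Q e p \<longleftrightarrow>
     p \<in> dual_domain \<and> dual_fun f G K Q (fst p) (snd p) \<ge> dual_opt_value f G K Q - e"

definition inexact_basic_ALM ::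
    "('a \<Rightarrow> ereal) \<Rightarrow> ('a \<Rightarrow> 'b::real_inner) \<Rightarrow> 'b set \<Rightarrow> 'a set \<Rightarrow> (nat \<Rightarrow> real) \<Rightarrow>
     (nat \<Rightarrow> 'a) \<Rightarrow> (nat \<Rightarrow> 'b) \<Rightarrow> (nat \<Rightarrow> real) \<Rightarrow> bool" where
  "inexact_basic_ALM f G K Q \<epsilon> x l c \<longleftrightarrow>
     l 0 \<in> polar_cone K \<and> 0 < c 0 \<and> (\<forall>n. 0 \<le> \<epsilon> n) \<and> bdd_above (range \<epsilon>) \<and>
     (\<forall>n. x n \<in> Q \<and>
          (\<forall>z\<in>Q. aug_lagrangian f G K (x n) (l n) (c n)
                  \<le> aug_lagrangian f G K z (l n) (c n) + ereal (\<epsilon> n)) \<and>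
          l (Suc n) \<in> polar_cone K \<and> c n \<le> c (Suc n))"

(* The maps p 0, ..., p (n-1) are the coordinates of an isometric isomorphism from the whole
   space onto R^n with its standard inner product (tuples are functions on nat of which only
   the values below n matter). *)
definition euclidean_coordinates :: "nat \<Rightarrow> (nat \<Rightarrow> 'b::real_inner \<Rightarrow> real) \<Rightarrow> bool" where
  "euclidean_coordinates n p \<longleftrightarrow>
     (\<forall>i<n. linear (p i)) \<and>
     (\<forall>a. \<exists>!y. \<forall>i<n. p i y = a i) \<and>
     (\<forall>y z. y \<bullet> z = (\<Sum>i<n. p i y * p i z))"

(* The space is R^(m+k) and K = {0} x (R_-)^k with 0 in R^m; m or k may be 0. *)
definition mixed_constraint_cone :: "'b::real_inner set \<Rightarrow> bool" where
  "mixed_constraint_cone K \<longleftrightarrow>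
     (\<exists>m k p. euclidean_coordinates (m + k) p \<and>
        K = {y. (\<forall>i<m. p i y = 0) \<and> (\<forall>i\<in>{m..<m + k}. p i y \<le> 0)})"

definition lsc_at_within :: "('a::topological_space \<Rightarrow> ereal) \<Rightarrow> 'a \<Rightarrow> 'a set \<Rightarrow> bool" where
  "lsc_at_within g x S \<longleftrightarrow> g x \<le> Liminf (at x within S) g"

definition lsc_on :: "'a::topological_space set \<Rightarrow> ('a \<Rightarrow> ereal) \<Rightarrow> bool" where
  "lsc_on S g \<longleftrightarrow> (\<forall>x\<in>S. lsc_at_within g x S)"

definition limit_point_of_seq :: "(nat \<Rightarrow> 'a::topological_space) \<Rightarrow> 'a \<Rightarrow> bool" where
  "limit_point_of_seq u z \<longleftrightarrow> (\<exists>r. strict_mono r \<and> (u \<circ> r) \<longlonglongrightarrow> z)"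

end

theory Submission
  imports Defs
begin

text \<open>Since \<open>K\<close> is a closed convex cone in a Hilbert space, Moreau's decomposition turns the norm of the
  projection onto the polar cone into the distance to \<open>K\<close>. Two estimates follow. If \<open>x\<close> is feasible
  for the problem perturbed by \<open>y\<close>, its augmented term is at most \<open>l \<bullet> y + c / 2 * \<parallel>y\<parallel>\<^sup>2\<close>
  (\<open>aug_term_le_perturbation\<close>); as this vanishes with \<open>y\<close>, every dual value is at most \<open>\<theta>_star\<close>, even
  where that is smaller than the optimal value (\<open>weak_duality\<close>). And the constraint violation of \<open>x\<close>
  is at most the multiplier step \<open>\<sigma>\<close> (\<open>infdist_le_multiplier_step\<close>).

  Along the iterates, \<open>\<sigma>\<close> tends to zero and the augmented terms \<open>\<phi>\<close> have nonnegative lower limit.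
  When the penalty parameters are unbounded, this comes from \<open>\<parallel>l\<parallel> / sqrt c \<longlonglongrightarrow> 0\<close> and the boundedness
  of \<open>\<phi>\<close> from above; when they are bounded, \<open>\<sigma> \<longlonglongrightarrow> 0\<close> is assumed, and since \<open>\<phi>\<close> is a difference of
  squares of vectors that are bounded and approach each other, even \<open>\<phi> \<longlonglongrightarrow> 0\<close>.

  Each iterate is thus feasible for a problem with vanishing perturbation, so the lower limit of the
  objective values is at least \<open>\<theta>_star\<close>. Approximate minimality and weak duality give
  \<open>f (x n) + \<phi> n \<le> \<Theta> n + \<epsilon> n \<le> \<theta>_star + \<epsilon> n\<close>, where \<open>\<Theta> n\<close> is the dual value. The lower limits of the two
  summands on the left add up to at least \<open>\<theta>_star\<close>, which leaves a slack of only \<open>\<epsilon> n\<close> for each of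
  \<open>\<phi>\<close>, \<open>f (x n)\<close> and \<open>\<Theta>\<close>: all the asymptotic bounds follow. The claims on limit points add lower
  semicontinuity of the objective and upper semicontinuity of the dual function
  (\<open>dual_fun_upper_semicontinuous\<close>).\<close>

section \<open>Projections onto closed convex cones\<close>

text \<open>By the parallelogram law, points of \<open>S\<close> that almost realise the distance to \<open>y\<close> are close to
  each other, since their midpoints cannot be closer to \<open>y\<close> than that distance. So every minimising
  sequence is Cauchy; completeness replaces the compactness available in finite dimension.\<close>

lemma nearest_point_exists:
  fixes S :: "'b::{real_inner, complete_space} set"
  assumes "closed S" "convex S" "S \<noteq> {}"
  shows "\<exists>z\<in>S. \<forall>v\<in>S. dist y z \<le> dist y v"
proof -
  define d where "d = infdist y S"
  define a where "a n = inverse (real (Suc n))" for n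
  have d0: "0 \<le> d" by (simp add: d_def infdist_nonneg)
  have d_le: "d \<le> dist y v" if "v \<in> S" for v
    using that by (simp add: d_def infdist_le)
  have "\<exists>v\<in>S. dist y v < d + a n" for n
  proof (rule ccontr)
    assume "\<not> ?thesis"
    then have "d + a n \<le> infdist y S"
      using assms(3) by (auto simp: infdist_notempty intro!: cINF_greatest)
    moreover have "a n > 0" by (simp add: a_def)
    ultimately show False by (simp add: d_def)
  qed
  then obtain v where vS: "\<And>n. v n \<in> S" and v: "\<And>n. dist y (v n) < d + a n" by metis
  have close: "(norm (v i - v j))\<^sup>2 \<le> 4 * (d + a N)\<^sup>2 - 4 * d\<^sup>2" if "i \<ge> N" "j \<ge> N" for i j N
  proof -
    define m where "m = (1/2) *\<^sub>R v i + (1/2) *\<^sub>R v j"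
    have "m \<in> S" unfolding m_def
      using convexD[OF assms(2) vS[of i] vS[of j], of "1/2" "1/2"] by simp
    then have 1: "d\<^sup>2 \<le> (norm (y - m))\<^sup>2"
      using d_le[of m] d0 by (simp add: dist_norm)
    have 2: "(norm (y - v k))\<^sup>2 \<le> (d + a N)\<^sup>2" if "k \<ge> N" for k
    proof -
      have "a k \<le> a N" using that by (simp add: a_def)
      then show ?thesis using v[of k] by (intro power_mono) (auto simp: dist_norm)
    qed
    have "(norm (v i - v j))\<^sup>2
        = 2 * (norm (y - v i))\<^sup>2 + 2 * (norm (y - v j))\<^sup>2 - 4 * (norm (y - m))\<^sup>2"
      unfolding m_def power2_norm_eq_inner by (simp add: inner_simps inner_commute field_simps)
    then show ?thesis using 1 2[OF that(1)] 2[OF that(2)] by linarith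
  qed
  have a0: "a \<longlonglongrightarrow> 0" unfolding a_def by (rule LIMSEQ_inverse_real_of_nat)
  have lim: "(\<lambda>N. 4 * (d + a N)\<^sup>2 - 4 * d\<^sup>2) \<longlonglongrightarrow> 0"
    using a0 by (auto intro!: tendsto_eq_intros)
  have "Cauchy v"
  proof (rule CauchyI)
    fix e :: real assume e: "0 < e"
    obtain N where N: "4 * (d + a N)\<^sup>2 - 4 * d\<^sup>2 < e\<^sup>2"
      using order_tendstoD(2)[OF lim, of "e\<^sup>2"] e by (auto simp: eventually_sequentially)
    have "norm (v i - v j) < e" if "i \<ge> N" "j \<ge> N" for i j
      using close[OF that] N e by (intro power2_less_imp_less[of _ e]) auto
    then show "\<exists>M. \<forall>m\<ge>M. \<forall>n\<ge>M. norm (v m - v n) < e" by blast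
  qed
  then obtain z where z: "v \<longlonglongrightarrow> z" using Cauchy_convergent convergent_def by blast
  have "z \<in> S" using closed_sequentially[OF assms(1) _ z] vS by blast
  moreover have "dist y z \<le> d + 0"
  proof (rule LIMSEQ_le)
    show "(\<lambda>n. dist y (v n)) \<longlonglongrightarrow> dist y z" using z by (intro tendsto_intros)
    show "(\<lambda>n. d + a n) \<longlonglongrightarrow> d + 0" using a0 by (intro tendsto_intros)
    show "\<exists>N. \<forall>n\<ge>N. dist y (v n) \<le> d + a n" using v less_imp_le by blast
  qed
  ultimately show ?thesis using d_le by force
qed

text \<open>Moreau's decomposition: \<open>y\<close> is the sum of its projections onto \<open>K\<close> and onto the polar cone.
  If \<open>q\<close> is nearest to \<open>y\<close> in \<open>K\<close>, the variational inequality tested with \<open>0\<close>, with \<open>2 q\<close> and then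
  with any point of \<open>K\<close> shows that \<open>y - q\<close> is orthogonal to \<open>q\<close> and polar to \<open>K\<close>; expanding
  \<open>\<parallel>q + ((y - q) - v)\<parallel>\<^sup>2\<close> for polar \<open>v\<close> then identifies \<open>y - q\<close> as the unique nearest polar point.
  Consequently the augmented term is governed by the distance to \<open>K\<close>.\<close>

lemma polar_cone_proj:
  fixes K :: "'b::{real_inner, complete_space} set"
  assumes "closed K" "convex K" "cone K" "K \<noteq> {}"
  shows diff_polar_cone_proj_in_cone: "y - metric_proj (polar_cone K) y \<in> K"
    and norm_polar_cone_proj: "norm (metric_proj (polar_cone K) y) = infdist y K"
proof -
  obtain q where qK: "q \<in> K" and q: "\<forall>v\<in>K. dist y q \<le> dist y v"
    using nearest_point_exists[OF assms(1,2,4)] by blast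
  define p where "p = y - q"
  have var: "p \<bullet> (k - q) \<le> 0" if "k \<in> K" for k
    using any_closest_point_dot[OF assms(2,1) qK that q] by (simp add: p_def)
  have scale: "t *\<^sub>R k \<in> K" if "k \<in> K" "t \<ge> 0" for k t
    using assms(3) that unfolding cone_def by blast
  have pq: "p \<bullet> q = 0"
    using var[OF scale[OF qK, of 0]] var[OF scale[OF qK, of 2]] by (simp add: inner_diff_right)
  have p_polar: "p \<in> polar_cone K"
    unfolding polar_cone_def using var pq by (auto simp: inner_diff_right)
  have pyth: "(dist y v)\<^sup>2 \<ge> (dist y p)\<^sup>2 + (norm (p - v))\<^sup>2" if "v \<in> polar_cone K" for v
  proof -
    have vq: "v \<bullet> q \<le> 0" using that qK by (auto simp: polar_cone_def)
    have "(norm (q + w))\<^sup>2 = (norm q)\<^sup>2 + (norm w)\<^sup>2 + 2 * (q \<bullet> w)" for w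
      unfolding power2_norm_eq_inner by (simp add: inner_add_left inner_add_right inner_commute)
    from this[of "p - v"]
    have "(norm (q + (p - v)))\<^sup>2 = (norm q)\<^sup>2 + (norm (p - v))\<^sup>2 + 2 * (q \<bullet> (p - v))" .
    moreover have eq: "q + (p - v) = y - v" "y - p = q" by (simp_all add: p_def)
    ultimately have "(dist y v)\<^sup>2 = (dist y p)\<^sup>2 + (norm (p - v))\<^sup>2 + 2 * (q \<bullet> (p - v))"
      by (simp only: dist_norm eq)
    then show ?thesis using pq vq by (simp add: inner_diff_right inner_commute)
  qed
  let ?near = "\<lambda>z. z \<in> polar_cone K \<and> (\<forall>v\<in>polar_cone K. dist y z \<le> dist y v)"
  have p_near: "?near p"
  proof (intro conjI ballI p_polar)
    fix v assume "v \<in> polar_cone K"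
    from pyth[OF this] have "(dist y p)\<^sup>2 \<le> (dist y v)\<^sup>2"
      using zero_le_power2[of "norm (p - v)"] by linarith
    then show "dist y p \<le> dist y v" by (rule power2_le_imp_le) simp
  qed
  have uniq: "z = p" if "?near z" for z
  proof -
    have "dist y z \<le> dist y p" using that p_polar by blast
    then have "(dist y z)\<^sup>2 \<le> (dist y p)\<^sup>2" by simp
    with pyth[of z] that have "(norm (p - z))\<^sup>2 \<le> 0" by linarith
    then show ?thesis by simp
  qed
  have proj: "metric_proj (polar_cone K) y = p"
    unfolding metric_proj_def by (rule some_equality, rule p_near, rule uniq)
  show "y - metric_proj (polar_cone K) y \<in> K" using proj qK by (simp add: p_def)
  have "infdist y K = dist y q"
  proof (rule antisym)
    show "infdist y K \<le> dist y q" using qK by (rule infdist_le)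
    show "dist y q \<le> infdist y K"
      using q assms(4) by (auto simp: infdist_notempty intro!: cINF_greatest)
  qed
  then show "norm (metric_proj (polar_cone K) y) = infdist y K"
    using proj by (simp add: p_def dist_norm)
qed

text \<open>With \<open>q\<close> the projection of \<open>u + t y\<close> onto \<open>K\<close>, the point \<open>q / t\<close> of \<open>K\<close> differs from \<open>y\<close> by
  exactly the difference on the right: the constraint violation is at most the step of the classical
  multiplier update divided by the penalty parameter.\<close>

lemma infdist_le_multiplier_step:
  fixes K :: "'b::{real_inner, complete_space} set"
  assumes "closed K" "convex K" "cone K" "K \<noteq> {}" "t > 0"
  shows "infdist y K \<le> 1 / t * norm (metric_proj (polar_cone K) (u + t *\<^sub>R y) - u)"
proof -
  define p where "p = metric_proj (polar_cone K) (u + t *\<^sub>R y)"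
  have "u + t *\<^sub>R y - p \<in> K" unfolding p_def using assms by (intro diff_polar_cone_proj_in_cone)
  then have "(1/t) *\<^sub>R (u + t *\<^sub>R y - p) \<in> K" using assms unfolding cone_def by simp
  then have "infdist y K \<le> dist y ((1/t) *\<^sub>R (u + t *\<^sub>R y - p))" by (rule infdist_le)
  also have "y - (1/t) *\<^sub>R (u + t *\<^sub>R y - p) = (1/t) *\<^sub>R (p - u)"
    using assms(5) by (simp add: algebra_simps)
  then have "dist y ((1/t) *\<^sub>R (u + t *\<^sub>R y - p)) = 1 / t * norm (p - u)"
    using assms(5) by (simp add: dist_norm)
  finally show ?thesis unfolding p_def .
qed

section \<open>The augmented term and weak duality\<close>

lemma aug_term_infdist:
  fixes G :: "'a \<Rightarrow> 'b::{real_inner, complete_space}"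
  assumes "closed K" "convex K" "cone K" "K \<noteq> {}"
  shows "aug_term G K x l c = 1 / (2 * c) * ((infdist (l + c *\<^sub>R G x) K)\<^sup>2 - (norm l)\<^sup>2)"
  unfolding aug_term_def using norm_polar_cone_proj[OF assms] by simp

text \<open>If \<open>x\<close> is feasible for the problem perturbed by \<open>y\<close>, then \<open>c (G x - y)\<close> is a point of \<open>K\<close> at
  distance \<open>\<parallel>l + c y\<parallel>\<close> from \<open>l + c G x\<close>. The bound no longer mentions \<open>x\<close>, which lets the augmented
  Lagrangian be compared with the optimal value function.\<close>

lemma aug_term_le_perturbation:
  fixes G :: "'a \<Rightarrow> 'b::{real_inner, complete_space}"
  assumes "closed K" "convex K" "cone K" "c > 0" and y: "G x - y \<in> K"
  shows "aug_term G K x l c \<le> l \<bullet> y + c / 2 * (norm y)\<^sup>2"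
proof -
  have "c *\<^sub>R (G x - y) \<in> K" using assms unfolding cone_def by simp
  then have "infdist (l + c *\<^sub>R G x) K \<le> dist (l + c *\<^sub>R G x) (c *\<^sub>R (G x - y))" by (rule infdist_le)
  also have "\<dots> = norm (l + c *\<^sub>R y)" by (simp add: dist_norm algebra_simps)
  finally have "(infdist (l + c *\<^sub>R G x) K)\<^sup>2 \<le> (norm (l + c *\<^sub>R y))\<^sup>2"
    by (intro power_mono infdist_nonneg)
  also have "\<dots> = (norm l)\<^sup>2 + 2 * c * (l \<bullet> y) + c\<^sup>2 * (norm y)\<^sup>2"
    unfolding power2_norm_eq_inner
    by (simp add: inner_add_left inner_add_right inner_commute power2_eq_square algebra_simps)
  finally have "1 / (2 * c) * ((infdist (l + c *\<^sub>R G x) K)\<^sup>2 - (norm l)\<^sup>2)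
      \<le> 1 / (2 * c) * (2 * c * (l \<bullet> y) + c\<^sup>2 * (norm y)\<^sup>2)"
    using \<open>c > 0\<close> by (intro mult_left_mono) auto
  also have "\<dots> = l \<bullet> y + c / 2 * (norm y)\<^sup>2"
    using \<open>c > 0\<close> by (simp add: field_simps power2_eq_square)
  finally have "1 / (2 * c) * ((infdist (l + c *\<^sub>R G x) K)\<^sup>2 - (norm l)\<^sup>2)
      \<le> l \<bullet> y + c / 2 * (norm y)\<^sup>2" .
  moreover have "K \<noteq> {}" using y by blast
  ultimately show ?thesis unfolding aug_term_infdist[OF assms(1-3) \<open>K \<noteq> {}\<close>] by blast
qed

text \<open>The dual function is bounded by the perturbed optimal values up to a term that vanishes with
  the perturbation. Letting the perturbation tend to zero bounds it by the lower limit of the optimal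
  value function, and not just by the optimal value. If the space is trivial, the punctured lower
  limit is \<open>\<infinity>\<close> and only the unperturbed bound is left.\<close>

lemma weak_duality:
  fixes G :: "'a \<Rightarrow> 'b::{real_inner, complete_space}"
  assumes "closed K" "convex K" "cone K" "c > 0"
  shows "dual_fun f G K Q l c \<le> min (opt_value f G K Q) (Liminf (at 0) (opt_value_fun f G K Q))"
proof -
  define h where "h y = l \<bullet> y + c / 2 * (norm y)\<^sup>2" for y
  have perturbed: "dual_fun f G K Q l c + ereal (- h y) \<le> opt_value_fun f G K Q y" for y
    unfolding opt_value_fun_def
  proof (rule INF_greatest)
    fix z assume "z \<in> {x \<in> Q. G x - y \<in> K}"
    then have z: "z \<in> Q" "G z - y \<in> K" by auto
    have "dual_fun f G K Q l c \<le> f z + ereal (aug_term G K z l c)"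
      unfolding dual_fun_def aug_lagrangian_def[symmetric] using z(1) by (rule INF_lower)
    also have "\<dots> \<le> f z + ereal (h y)"
      using aug_term_le_perturbation[where G = G and x = z and l = l, OF assms z(2)]
      by (intro add_left_mono) (simp add: h_def)
    finally show "dual_fun f G K Q l c + ereal (- h y) \<le> f z"
      by (cases "f z"; cases "dual_fun f G K Q l c") auto
  qed
  have "opt_value_fun f G K Q 0 = opt_value f G K Q"
    by (simp add: opt_value_fun_def opt_value_def feasible_set_def)
  then have 1: "dual_fun f G K Q l c \<le> opt_value f G K Q"
    using perturbed[of 0] by (simp add: h_def)
  have 2: "dual_fun f G K Q l c \<le> Liminf (at 0) (opt_value_fun f G K Q)"
  proof (cases "at (0::'b) = bot")
    case False
    have "(h \<longlongrightarrow> 0) (at 0)"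
      unfolding h_def by (auto intro!: tendsto_eq_intros)
    then have "((\<lambda>y. ereal (- h y)) \<longlongrightarrow> ereal (- 0)) (at 0)"
      by (intro tendsto_intros)
    then have "((\<lambda>y. dual_fun f G K Q l c + ereal (- h y))
        \<longlongrightarrow> dual_fun f G K Q l c + ereal (- 0)) (at 0)"
      by (intro tendsto_add_ereal_general tendsto_const) auto
    then have "Liminf (at 0) (\<lambda>y. dual_fun f G K Q l c + ereal (- h y)) = dual_fun f G K Q l c"
      using lim_imp_Liminf[OF False] by fastforce
    then show ?thesis using Liminf_mono[OF always_eventually[of "\<lambda>y. _ y \<le> _ y"]] perturbed by metis
  qed simp
  from 1 2 show ?thesis by simp
qed

text \<open>As an infimum of functions continuous in the dual variables, the dual function is upper
  semicontinuous, so a lower bound that holds along a convergent sequence survives in the limit.\<close>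

lemma dual_fun_upper_semicontinuous:
  fixes G :: "'a \<Rightarrow> 'b::{real_inner, complete_space}"
  assumes "closed K" "convex K" "cone K" "K \<noteq> {}"
    and l: "l \<longlonglongrightarrow> l'" and c: "c \<longlonglongrightarrow> c'" and "c' > 0"
    and f: "\<And>z. f z \<noteq> -\<infinity>"
  shows "liminf (\<lambda>n. dual_fun f G K Q (l n) (c n)) \<le> dual_fun f G K Q l' c'"
  unfolding dual_fun_def[of f G K Q l' c']
proof (rule INF_greatest)
  fix z assume z: "z \<in> Q"
  have "(\<lambda>n. aug_term G K z (l n) (c n)) \<longlonglongrightarrow> aug_term G K z l' c'"
    unfolding aug_term_infdist[OF assms(1-4)] using \<open>c' > 0\<close>
    by (intro tendsto_intros l c) auto
  then have "(\<lambda>n. f z + ereal (aug_term G K z (l n) (c n))) \<longlonglongrightarrow> aug_lagrangian f G K z l' c'"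
    unfolding aug_lagrangian_def using f[of z] by (intro tendsto_add_ereal_general tendsto_const) auto
  then have "liminf (\<lambda>n. f z + ereal (aug_term G K z (l n) (c n))) = aug_lagrangian f G K z l' c'"
    using lim_imp_Liminf trivial_limit_sequentially by blast
  moreover have "dual_fun f G K Q (l n) (c n) \<le> f z + ereal (aug_term G K z (l n) (c n))" for n
    unfolding dual_fun_def aug_lagrangian_def[symmetric] using z by (rule INF_lower)
  ultimately show "liminf (\<lambda>n. dual_fun f G K Q (l n) (c n)) \<le> aug_lagrangian f G K z l' c'"
    by (metis (no_types, lifting) Liminf_mono always_eventually)
qed

section \<open>Lower and upper limits\<close>

text \<open>Lower limits at a point are punctured, whereas a convergent sequence may visit its limit; the
  extra bound on the value there covers those indices.\<close>

lemma liminf_along_sequence: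
  fixes g :: "'a::topological_space \<Rightarrow> ereal"
  assumes "a \<le> g z" and "a \<le> Liminf (at z within S) g"
    and u: "u \<longlonglongrightarrow> z" and "\<And>n. u n \<in> S"
  shows "a \<le> liminf (\<lambda>n. g (u n))"
  unfolding le_Liminf_iff
proof (intro allI impI)
  fix b assume b: "b < a"
  then have "eventually (\<lambda>w. b < g w) (at z within S)"
    using assms(2) by (simp add: le_Liminf_iff)
  then have "eventually (\<lambda>w. w \<in> S \<longrightarrow> b < g w) (nhds z)"
    unfolding eventually_at_filter by eventually_elim (use b assms(1) in force)
  from filterlim_iff[THEN iffD1, OF u, rule_format, OF this]
  show "eventually (\<lambda>n. b < g (u n)) sequentially" using assms(4) by simp
qed

lemma limsup_le_add_limsup:
  fixes u e :: "nat \<Rightarrow> real"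
  assumes "\<And>d. d > 0 \<Longrightarrow> eventually (\<lambda>n. u n \<le> a + e n + d) sequentially"
  shows "limsup (\<lambda>n. ereal (u n)) \<le> ereal a + limsup (\<lambda>n. ereal (e n))"
proof (rule ereal_le_epsilon2)
  fix d :: real assume "d > 0"
  from assms[OF this]
  have "limsup (\<lambda>n. ereal (u n)) \<le> limsup (\<lambda>n. ereal (a + d) + ereal (e n))"
    by (intro Limsup_mono) (auto elim: eventually_mono)
  also have "\<dots> = ereal (a + d) + limsup (\<lambda>n. ereal (e n))"
    by (intro Limsup_add_ereal_left) auto
  also have "\<dots> = ereal a + limsup (\<lambda>n. ereal (e n)) + ereal d"
    by (cases "limsup (\<lambda>n. ereal (e n))") auto
  finally show "limsup (\<lambda>n. ereal (u n)) \<le> ereal a + limsup (\<lambda>n. ereal (e n)) + ereal d" .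
qed

section \<open>Multiplier steps and augmented terms along the iterates\<close>

text \<open>An upper bound \<open>C\<close> on the augmented terms, which may be taken nonnegative, gives
  \<open>\<parallel>p\<^sub>n\<parallel> \<le> sqrt (2 C c\<^sub>n) + \<parallel>l\<^sub>n\<parallel>\<close>, which divided by \<open>c\<^sub>n\<close> vanishes,
  even when the multipliers are unbounded.\<close>

lemma step_tendsto_zero_unbounded_penalty:
  fixes p l :: "nat \<Rightarrow> 'b::real_inner"
  assumes c: "filterlim c at_top sequentially" and pos: "\<And>n. 0 < c n"
    and ratio: "(\<lambda>n. norm (l n) / sqrt (c n)) \<longlonglongrightarrow> 0"
    and C: "\<And>n. 1 / (2 * c n) * ((norm (p n))\<^sup>2 - (norm (l n))\<^sup>2) \<le> C"
  shows "(\<lambda>n. 1 / c n * norm (p n - l n)) \<longlonglongrightarrow> 0"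
proof (rule tendsto_sandwich[OF _ _ tendsto_const])
  define D where "D = max C 0"
  have inv: "(\<lambda>n. 1 / sqrt (c n)) \<longlonglongrightarrow> 0"
    using tendsto_divide_0[OF tendsto_const filterlim_at_top_imp_at_infinity
        [OF filterlim_compose[OF sqrt_at_top c]]] .
  show "(\<lambda>n. sqrt (2 * D) * (1 / sqrt (c n)) + 2 * (norm (l n) / sqrt (c n)) * (1 / sqrt (c n)))
      \<longlonglongrightarrow> 0"
    using tendsto_add[OF tendsto_mult[OF tendsto_const[of "sqrt (2 * D)"] inv]
        tendsto_mult[OF tendsto_mult[OF tendsto_const[of 2] ratio] inv]] by simp
  show "\<forall>\<^sub>F n in sequentially. 1 / c n * norm (p n - l n)
      \<le> sqrt (2 * D) * (1 / sqrt (c n)) + 2 * (norm (l n) / sqrt (c n)) * (1 / sqrt (c n))"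
  proof (intro always_eventually allI)
    fix n
    define s where "s = sqrt (c n)"
    have s: "s > 0" "c n = s\<^sup>2" using pos[of n] by (auto simp: s_def)
    have "1 / (2 * c n) * ((norm (p n))\<^sup>2 - (norm (l n))\<^sup>2) \<le> D" using C[of n] by (simp add: D_def)
    then have "(norm (p n))\<^sup>2 \<le> 2 * D * s\<^sup>2 + (norm (l n))\<^sup>2"
      using s by (simp add: field_simps)
    also have "2 * D * s\<^sup>2 = (sqrt (2 * D) * s)\<^sup>2" by (simp add: power_mult_distrib D_def)
    also have "(sqrt (2 * D) * s)\<^sup>2 + (norm (l n))\<^sup>2 \<le> (sqrt (2 * D) * s + norm (l n))\<^sup>2"
      using s by (simp add: power2_sum D_def)
    finally have "norm (p n) \<le> sqrt (2 * D) * s + norm (l n)"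
      by (rule power2_le_imp_le) (use s in \<open>simp add: D_def\<close>)
    then have "norm (p n - l n) \<le> sqrt (2 * D) * s + 2 * norm (l n)"
      using norm_triangle_ineq4[of "p n" "l n"] by linarith
    then have "1 / c n * norm (p n - l n) \<le> 1 / c n * (sqrt (2 * D) * s + 2 * norm (l n))"
      using pos[of n] by (intro mult_left_mono) auto
    also have "\<dots> = sqrt (2 * D) * (1 / s) + 2 * (norm (l n) / s) * (1 / s)"
      using s by (simp add: field_simps power2_eq_square)
    finally show "1 / c n * norm (p n - l n)
      \<le> sqrt (2 * D) * (1 / sqrt (c n)) + 2 * (norm (l n) / sqrt (c n)) * (1 / sqrt (c n))"
      unfolding s_def .
  qed
  show "\<forall>\<^sub>F n in sequentially. 0 \<le> 1 / c n * norm (p n - l n)"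
    using pos by (intro always_eventually allI) (simp add: less_imp_le)
qed

text \<open>The lower bound drops the square of the projection and keeps minus half the square of
  \<open>\<parallel>l\<^sub>n\<parallel> / sqrt c\<^sub>n\<close>.\<close>

lemma aug_term_lower_bound_unbounded_penalty:
  fixes p l :: "nat \<Rightarrow> 'b::real_inner"
  assumes pos: "\<And>n. 0 < c n" and ratio: "(\<lambda>n. norm (l n) / sqrt (c n)) \<longlonglongrightarrow> 0" and "d > 0"
  shows "\<forall>\<^sub>F n in sequentially. - d < 1 / (2 * c n) * ((norm (p n))\<^sup>2 - (norm (l n))\<^sup>2)"
proof -
  have "(\<lambda>n. - (1/2) * (norm (l n) / sqrt (c n))\<^sup>2) \<longlonglongrightarrow> 0"
    using tendsto_mult[OF tendsto_const[of "- (1/2)"] tendsto_power[OF ratio, of 2]] by simp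
  then have "\<forall>\<^sub>F n in sequentially. - d < - (1/2) * (norm (l n) / sqrt (c n))\<^sup>2"
    by (rule order_tendstoD(1)) (use \<open>d > 0\<close> in simp)
  then show ?thesis
  proof eventually_elim
    case (elim n)
    have "- (1/2) * (norm (l n) / sqrt (c n))\<^sup>2 = 1 / (2 * c n) * (0 - (norm (l n))\<^sup>2)"
      using pos[of n] by (simp add: power_divide)
    also have "\<dots> \<le> 1 / (2 * c n) * ((norm (p n))\<^sup>2 - (norm (l n))\<^sup>2)"
      using pos[of n] by (intro mult_left_mono) auto
    finally show ?case using elim by linarith
  qed
qed

text \<open>The difference of squares factors as \<open>(\<parallel>p\<^sub>n\<parallel> - \<parallel>l\<^sub>n\<parallel>) (\<parallel>p\<^sub>n\<parallel> + \<parallel>l\<^sub>n\<parallel>)\<close>. Divided by \<open>c\<^sub>n\<close>, its first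
  factor is at most the multiplier step, and the second is bounded, \<open>p\<^sub>n\<close> lying within
  \<open>c\<^sub>n\<close> times that step of \<open>l\<^sub>n\<close>.\<close>

lemma aug_term_tendsto_zero_bounded_penalty:
  fixes p l :: "nat \<Rightarrow> 'b::real_inner"
  assumes pos: "\<And>n. 0 < c n" and c: "bounded (range c)" and l: "bounded (range l)"
    and step: "(\<lambda>n. 1 / c n * norm (p n - l n)) \<longlonglongrightarrow> 0"
  shows "(\<lambda>n. 1 / (2 * c n) * ((norm (p n))\<^sup>2 - (norm (l n))\<^sup>2)) \<longlonglongrightarrow> 0"
proof -
  define \<sigma> where "\<sigma> n = 1 / c n * norm (p n - l n)" for n
  obtain B where B: "\<And>n. norm (l n) \<le> B" using l by (auto simp: bounded_iff)
  obtain A where "\<And>n. norm (c n) \<le> A" using c by (auto simp: bounded_iff)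
  then have A: "c n \<le> A" for n using abs_ge_self[of "c n"] by (metis order_trans real_norm_def)
  have \<sigma>: "\<sigma> \<longlonglongrightarrow> 0" using step by (simp add: \<sigma>_def[abs_def])
  have bound: "norm (1 / (2 * c n) * ((norm (p n))\<^sup>2 - (norm (l n))\<^sup>2))
      \<le> 1/2 * \<sigma> n * (A * \<sigma> n + 2 * B)" for n
  proof -
    have \<sigma>0: "\<sigma> n \<ge> 0" using pos[of n] by (simp add: \<sigma>_def)
    have diff: "norm (p n - l n) = c n * \<sigma> n" using pos[of n] by (simp add: \<sigma>_def)
    also have "\<dots> \<le> A * \<sigma> n" using A \<sigma>0 by (intro mult_right_mono)
    finally have sum: "norm (p n) + norm (l n) \<le> A * \<sigma> n + 2 * B"
      using norm_triangle_ineq2[of "p n" "l n"] B[of n] by linarith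
    have "\<bar>(norm (p n))\<^sup>2 - (norm (l n))\<^sup>2\<bar> = \<bar>norm (p n) - norm (l n)\<bar> * (norm (p n) + norm (l n))"
      by (simp add: power2_eq_square square_diff_square_factored abs_mult)
    also have "\<dots> \<le> (c n * \<sigma> n) * (A * \<sigma> n + 2 * B)"
      using norm_triangle_ineq3[of "p n" "l n"] sum diff
      by (intro mult_mono) auto
    finally show ?thesis
      using pos[of n] by (simp add: abs_mult field_simps)
  qed
  show ?thesis
  proof (rule Lim_null_comparison)
    show "(\<lambda>n. 1/2 * \<sigma> n * (A * \<sigma> n + 2 * B)) \<longlonglongrightarrow> 0"
      using \<sigma> by (auto intro!: tendsto_eq_intros)
  qed (use bound in auto)
qed

section \<open>Convergence of the method\<close>

theorem theorem5:
  fixes f :: "'a::metric_space \<Rightarrow> ereal"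
    and G :: "'a \<Rightarrow> 'b::{real_inner, complete_space}"
    and K :: "'b set" and Q :: "'a set"
    and x :: "nat \<Rightarrow> 'a" and l :: "nat \<Rightarrow> 'b" and c :: "nat \<Rightarrow> real" and \<epsilon> :: "nat \<Rightarrow> real"
  defines "\<beta> \<equiv> opt_value_fun f G K Q"
    and "f_star \<equiv> opt_value f G K Q"
    and "\<epsilon>_star \<equiv> limsup (\<lambda>n. ereal (\<epsilon> n))"
    and "\<theta>_star \<equiv> min (opt_value f G K Q) (Liminf (at 0) (opt_value_fun f G K Q))"
  assumes "Q \<noteq> {}" and "closed Q"
    and "\<And>z. f z \<noteq> -\<infinity>"
    and "closed K" and "convex K" and "cone K"
    and "feasible_set G K Q \<noteq> {}"
    and "\<bar>f_star\<bar> \<noteq> \<infinity>"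
    and "inexact_basic_ALM f G K Q \<epsilon> x l c"
    and "\<And>n. \<exists>r::real. \<forall>z\<in>Q. ereal r \<le> aug_lagrangian f G K z (l n) (c n)"
    and "\<exists>r::real. \<forall>n. ereal r \<le> f (x n)"
    and "filterlim c at_top sequentially \<Longrightarrow> (\<lambda>n. norm (l n) / sqrt (c n)) \<longlonglongrightarrow> 0"
    and "bounded (range c) \<Longrightarrow> bounded (range l)"
    and "bounded (range c) \<Longrightarrow>
           (\<lambda>n. 1 / c n * norm (metric_proj (polar_cone K) (l n + c n *\<^sub>R G (x n)) - l n))
             \<longlonglongrightarrow> 0"
    and "bounded (range c) \<Longrightarrow>
           bounded (range (\<lambda>n. metric_proj K (G (x n)))) \<or> mixed_constraint_cone K"
  shows "(\<lambda>n. infdist (G (x n)) K) \<longlonglongrightarrow> 0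
    \<and> limsup (\<lambda>n. ereal (aug_term G K (x n) (l n) (c n))) \<le> \<epsilon>_star
    \<and> \<theta>_star \<le> liminf (\<lambda>n. f (x n))
    \<and> liminf (\<lambda>n. f (x n)) \<le> limsup (\<lambda>n. f (x n))
    \<and> limsup (\<lambda>n. f (x n)) \<le> \<theta>_star + \<epsilon>_star
    \<and> \<theta>_star - \<epsilon>_star \<le> liminf (\<lambda>n. dual_fun f G K Q (l n) (c n))
    \<and> liminf (\<lambda>n. dual_fun f G K Q (l n) (c n)) \<le> limsup (\<lambda>n. dual_fun f G K Q (l n) (c n))
    \<and> limsup (\<lambda>n. dual_fun f G K Q (l n) (c n)) \<le> \<theta>_star
    \<and> (lsc_at_within \<beta> 0 UNIV \<longrightarrow>
         \<theta>_star = f_star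
         \<and> (lsc_on Q f \<and> continuous_on Q G \<longrightarrow>
              (\<forall>z. limit_point_of_seq x z \<longrightarrow> eps_optimal f G K Q \<epsilon>_star z))
         \<and> (bounded (range c) \<longrightarrow>
              (\<forall>p. limit_point_of_seq (\<lambda>n. (l n, c n)) p \<longrightarrow>
                   dual_eps_optimal f G K Q \<epsilon>_star p)))"
proof -
  define \<phi> where "\<phi> n = aug_term G K (x n) (l n) (c n)" for n
  define \<sigma> where "\<sigma> n = 1 / c n * norm (metric_proj (polar_cone K) (l n + c n *\<^sub>R G (x n)) - l n)"
    for n
  define p where "p n = metric_proj (polar_cone K) (l n + c n *\<^sub>R G (x n))" for n
  note K = \<open>closed K\<close> \<open>convex K\<close> \<open>cone K\<close>
  have Kne: "K \<noteq> {}" using \<open>feasible_set G K Q \<noteq> {}\<close> by (auto simp: feasible_set_def)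
  note alm = \<open>inexact_basic_ALM f G K Q \<epsilon> x l c\<close>[unfolded inexact_basic_ALM_def]
  have xQ: "x n \<in> Q" for n using alm by blast
  have c_mono: "incseq c" using alm by (intro incseq_SucI) blast
  have c_ge: "c 0 \<le> c n" and pos: "0 < c n" for n
    using incseqD[OF c_mono, of 0 n] alm by auto
  have \<epsilon>0: "\<epsilon> n \<ge> 0" for n using alm by blast
  obtain E where E: "\<And>n. \<epsilon> n \<le> E" using alm by (auto simp: bdd_above_def)
  have \<phi>_eq: "\<phi> n = 1 / (2 * c n) * ((norm (p n))\<^sup>2 - (norm (l n))\<^sup>2)" for n
    by (simp add: \<phi>_def p_def aug_term_def)
  have \<sigma>_eq: "\<sigma> n = 1 / c n * norm (p n - l n)" for n
    by (simp add: \<sigma>_def p_def)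

  \<comment> \<open>Every extended real that occurs is finite: the dual values because they are bounded below by
    assumption and above by weak duality, and \<open>f (x n)\<close> because of the approximate minimality.\<close>
  have weak: "dual_fun f G K Q u t \<le> \<theta>_star" if "t > 0" for u t
    unfolding \<theta>_star_def by (rule weak_duality[OF K that])
  have \<theta>_le: "\<theta>_star \<le> f_star" by (simp add: \<theta>_star_def f_star_def)
  have dual_gt: "dual_fun f G K Q (l n) (c n) \<noteq> -\<infinity>" for n
  proof -
    obtain r where "\<forall>z\<in>Q. ereal r \<le> aug_lagrangian f G K z (l n) (c n)"
      using assms(14)[of n] by blast
    then have "ereal r \<le> dual_fun f G K Q (l n) (c n)"
      unfolding dual_fun_def by (intro INF_greatest) blast
    then show ?thesis by auto
  qed
  obtain th where th: "\<theta>_star = ereal th"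
    using weak[OF pos[of 0], of "l 0"] dual_gt[of 0] \<theta>_le \<open>\<bar>f_star\<bar> \<noteq> \<infinity>\<close> by (cases \<theta>_star) auto
  have "\<exists>t. dual_fun f G K Q (l n) (c n) = ereal t \<and> t \<le> th" for n
    using weak[OF pos[of n], of "l n"] dual_gt[of n] th
    by (cases "dual_fun f G K Q (l n) (c n)") auto
  then obtain T where T: "\<And>n. dual_fun f G K Q (l n) (c n) = ereal (T n)" and T_le: "\<And>n. T n \<le> th"
    by metis
  have near_min: "f (x n) + ereal (\<phi> n) \<le> ereal (T n) + ereal (\<epsilon> n)" for n
  proof -
    have "f (x n) + ereal (\<phi> n) - ereal (\<epsilon> n) \<le> dual_fun f G K Q (l n) (c n)"
      unfolding dual_fun_def
    proof (rule INF_greatest)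
      fix z assume "z \<in> Q"
      then have "f (x n) + ereal (\<phi> n) \<le> aug_lagrangian f G K z (l n) (c n) + ereal (\<epsilon> n)"
        using alm unfolding \<phi>_def aug_lagrangian_def by blast
      then show "f (x n) + ereal (\<phi> n) - ereal (\<epsilon> n) \<le> aug_lagrangian f G K z (l n) (c n)"
        by (simp add: ereal_minus_le)
    qed
    then show ?thesis unfolding T by (simp add: ereal_minus_le)
  qed
  obtain r where r: "\<And>n. ereal r \<le> f (x n)" using assms(15) by blast
  have "\<exists>t. f (x n) = ereal t" for n
    using r[of n] near_min[of n] by (cases "f (x n)") auto
  then obtain F where F: "\<And>n. f (x n) = ereal (F n)" by metis
  have F_ge: "r \<le> F n" for n using r[of n] F by simp
  have FT: "F n + \<phi> n \<le> T n + \<epsilon> n" for n using near_min[of n] F by simp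

  have \<phi>_le: "\<phi> n \<le> th + E - r" for n using FT[of n] T_le[of n] E[of n] F_ge[of n] by linarith
  have \<sigma>_lim: "\<sigma> \<longlonglongrightarrow> 0" and \<phi>_lower: "\<And>d. d > 0 \<Longrightarrow> \<forall>\<^sub>F n in sequentially. - d < \<phi> n"
  proof -
    have "\<sigma> \<longlonglongrightarrow> 0 \<and> (\<forall>d>0. \<forall>\<^sub>F n in sequentially. - d < \<phi> n)"
    proof (cases "bounded (range c)")
      case True
      have s: "\<sigma> \<longlonglongrightarrow> 0" using assms(18)[OF True] by (simp add: \<sigma>_def[abs_def])
      have "\<phi> \<longlonglongrightarrow> 0"
        using aug_term_tendsto_zero_bounded_penalty[OF pos True assms(17)[OF True]] s
        by (simp add: \<phi>_eq[abs_def] \<sigma>_eq[abs_def])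
      then show ?thesis using s order_tendstoD(1) by (metis neg_less_0_iff_less)
    next
      case False
      have "filterlim c at_top sequentially"
        unfolding filterlim_at_top
      proof
        fix Z
        have "\<exists>n. c n \<ge> Z"
        proof (rule ccontr)
          assume "\<not> ?thesis"
          then have "range c \<subseteq> {c 0..Z}" using c_ge by (auto simp: not_le less_imp_le)
          then show False using False bounded_closed_interval bounded_subset by blast
        qed
        then obtain N where "Z \<le> c N" by blast
        then show "\<forall>\<^sub>F n in sequentially. Z \<le> c n"
          using c_mono by (auto simp: eventually_sequentially incseq_def intro: order_trans)
      qed
      note c_top = this and ratio = assms(16)[OF this]
      have "\<sigma> \<longlonglongrightarrow> 0" unfolding \<sigma>_eq[abs_def]
        by (rule step_tendsto_zero_unbounded_penalty[OF c_top pos ratio]) (rule \<phi>_le[unfolded \<phi>_eq])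
      moreover have "\<forall>\<^sub>F n in sequentially. - d < \<phi> n" if "d > 0" for d
        unfolding \<phi>_eq using aug_term_lower_bound_unbounded_penalty[OF pos ratio that] .
      ultimately show ?thesis by blast
    qed
    then show "\<sigma> \<longlonglongrightarrow> 0" "\<And>d. d > 0 \<Longrightarrow> \<forall>\<^sub>F n in sequentially. - d < \<phi> n" by auto
  qed

  have dist_lim: "(\<lambda>n. infdist (G (x n)) K) \<longlonglongrightarrow> 0"
  proof (rule tendsto_sandwich[OF _ _ tendsto_const \<sigma>_lim])
    show "\<forall>\<^sub>F n in sequentially. infdist (G (x n)) K \<le> \<sigma> n"
      unfolding \<sigma>_def using infdist_le_multiplier_step[OF K Kne pos] by (intro always_eventually) blast
  qed (simp add: infdist_nonneg)

  \<comment> \<open>Each iterate is feasible for the problem perturbed by its own constraint violation \<open>y n\<close>.\<close>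
  have F_liminf: "\<theta>_star \<le> liminf (\<lambda>n. f (x n))"
  proof -
    have "\<exists>y. G (x n) - y \<in> K \<and> norm y = infdist (G (x n)) K" for n
      using diff_polar_cone_proj_in_cone[OF K Kne] norm_polar_cone_proj[OF K Kne] by blast
    then obtain y where yK: "\<And>n. G (x n) - y n \<in> K"
      and y_norm: "\<And>n. norm (y n) = infdist (G (x n)) K" by metis
    have "y \<longlonglongrightarrow> 0"
      by (rule tendsto_norm_zero_cancel) (simp add: y_norm dist_lim)
    moreover have "\<theta>_star \<le> opt_value_fun f G K Q 0"
      using \<theta>_le by (simp add: f_star_def opt_value_fun_def opt_value_def feasible_set_def)
    moreover have "\<theta>_star \<le> Liminf (at 0) (opt_value_fun f G K Q)"
      by (simp add: \<theta>_star_def)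
    ultimately have "\<theta>_star \<le> liminf (\<lambda>n. opt_value_fun f G K Q (y n))"
      by (intro liminf_along_sequence[where S = UNIV and z = 0
            and g = "opt_value_fun f G K Q"]) auto
    also have "\<dots> \<le> liminf (\<lambda>n. f (x n))"
      unfolding opt_value_fun_def
      by (intro Liminf_mono always_eventually allI INF_lower) (use xQ yK in simp)
    finally show ?thesis .
  qed
  have F_lower: "\<forall>\<^sub>F n in sequentially. th - d < F n" if "d > 0" for d
  proof -
    have "ereal (th - d) < \<theta>_star" using that th by simp
    then show ?thesis using F_liminf unfolding le_Liminf_iff F by auto
  qed

  \<comment> \<open>In \<open>F n + \<phi> n \<le> T n + \<epsilon> n \<le> th + \<epsilon> n\<close> both summands on the left are asymptotically bounded below,
    by \<open>th\<close> and by \<open>0\<close>. This squeezes each of the three sequences up to the tolerance.\<close>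
  have \<phi>_limsup: "limsup (\<lambda>n. ereal (\<phi> n)) \<le> \<epsilon>_star"
  proof -
    have "limsup (\<lambda>n. ereal (\<phi> n)) \<le> ereal 0 + limsup (\<lambda>n. ereal (\<epsilon> n))"
    proof (rule limsup_le_add_limsup)
      fix d :: real assume "d > 0"
      from F_lower[OF this] show "\<forall>\<^sub>F n in sequentially. \<phi> n \<le> 0 + \<epsilon> n + d"
      proof eventually_elim
        case (elim n) then show ?case using FT[of n] T_le[of n] by linarith
      qed
    qed
    then show ?thesis by (simp add: \<epsilon>_star_def)
  qed
  have F_limsup: "limsup (\<lambda>n. f (x n)) \<le> \<theta>_star + \<epsilon>_star"
    unfolding F th \<epsilon>_star_def
  proof (rule limsup_le_add_limsup)
    fix d :: real assume "d > 0"
    from \<phi>_lower[OF this] show "\<forall>\<^sub>F n in sequentially. F n \<le> th + \<epsilon> n + d"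
    proof eventually_elim
      case (elim n) then show ?case using FT[of n] T_le[of n] by linarith
    qed
  qed
  have \<epsilon>_fin: "\<bar>\<epsilon>_star\<bar> \<noteq> \<infinity>"
  proof -
    have "0 \<le> \<epsilon>_star" unfolding \<epsilon>_star_def using \<epsilon>0
      by (intro order_trans[OF _ Liminf_le_Limsup] Liminf_bounded) auto
    moreover have "\<epsilon>_star \<le> ereal E" unfolding \<epsilon>_star_def using E
      by (intro Limsup_bounded) auto
    ultimately show ?thesis by auto
  qed
  have T_liminf: "\<theta>_star - \<epsilon>_star \<le> liminf (\<lambda>n. dual_fun f G K Q (l n) (c n))"
  proof -
    have "limsup (\<lambda>n. ereal (- T n)) \<le> ereal (- th) + \<epsilon>_star"
      unfolding \<epsilon>_star_def
    proof (rule limsup_le_add_limsup)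
      fix d :: real assume "d > 0"
      then have "d / 2 > 0" by simp
      from F_lower[OF this] \<phi>_lower[OF this]
      show "\<forall>\<^sub>F n in sequentially. - T n \<le> - th + \<epsilon> n + d"
      proof eventually_elim
        case (elim n) then show ?case using FT[of n] by linarith
      qed
    qed
    moreover have "limsup (\<lambda>n. ereal (- T n)) = - liminf (\<lambda>n. ereal (T n))"
      using ereal_Limsup_uminus[of sequentially "\<lambda>n. ereal (T n)"] by simp
    ultimately show ?thesis
      unfolding T th using \<epsilon>_fin
      by (cases \<epsilon>_star; cases "liminf (\<lambda>n. ereal (T n))") auto
  qed
  have T_limsup: "limsup (\<lambda>n. dual_fun f G K Q (l n) (c n)) \<le> \<theta>_star"
    using weak pos by (intro Limsup_bounded always_eventually) blast

  have \<theta>_eq: "\<theta>_star = f_star" if "lsc_at_within \<beta> 0 UNIV"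
  proof -
    have "opt_value_fun f G K Q 0 = opt_value f G K Q"
      by (simp add: opt_value_fun_def opt_value_def feasible_set_def)
    then show ?thesis
      using that unfolding lsc_at_within_def \<beta>_def \<theta>_star_def f_star_def by (simp add: min_def)
  qed

  have primal: "eps_optimal f G K Q \<epsilon>_star z"
    if lsc: "lsc_at_within \<beta> 0 UNIV" and f: "lsc_on Q f" and G: "continuous_on Q G"
      and z: "limit_point_of_seq x z" for z
  proof -
    obtain s where s: "strict_mono s" "(\<lambda>n. x (s n)) \<longlonglongrightarrow> z"
      using z by (auto simp: limit_point_of_seq_def o_def)
    have zQ: "z \<in> Q" using closed_sequentially[OF \<open>closed Q\<close> _ s(2)] xQ by blast
    have "(\<lambda>n. G (x (s n))) \<longlonglongrightarrow> G z"
      using continuous_on_tendsto_compose[OF G s(2) zQ] xQ by simp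
    then have "(\<lambda>n. infdist (G (x (s n))) K) \<longlonglongrightarrow> infdist (G z) K" by (rule tendsto_infdist)
    moreover have "(\<lambda>n. infdist (G (x (s n))) K) \<longlonglongrightarrow> 0"
      using LIMSEQ_subseq_LIMSEQ[OF dist_lim s(1)] by (simp add: o_def)
    ultimately have "infdist (G z) K = 0" by (rule LIMSEQ_unique)
    then have "G z \<in> K" using in_closed_iff_infdist_zero[OF \<open>closed K\<close> Kne] by blast
    have "f z \<le> liminf (\<lambda>n. f (x (s n)))"
      using f zQ xQ s(2) unfolding lsc_on_def lsc_at_within_def
      by (intro liminf_along_sequence[where S = Q and z = z and g = f]) auto
    also have "\<dots> \<le> limsup (\<lambda>n. f (x (s n)))" by (intro Liminf_le_Limsup) simp
    also have "\<dots> \<le> limsup (\<lambda>n. f (x n))"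
      using limsup_subseq_mono[OF s(1), of "\<lambda>n. f (x n)"] by (simp add: o_def)
    also note F_limsup
    finally have "f z \<le> opt_value f G K Q + \<epsilon>_star" using \<theta>_eq[OF lsc] by (simp add: f_star_def)
    then show ?thesis using zQ \<open>G z \<in> K\<close> by (simp add: eps_optimal_def feasible_set_def)
  qed

  have dual: "dual_eps_optimal f G K Q \<epsilon>_star q" if q: "limit_point_of_seq (\<lambda>n. (l n, c n)) q" for q
  proof -
    obtain s where s: "strict_mono s" "(\<lambda>n. (l (s n), c (s n))) \<longlonglongrightarrow> q"
      using q by (auto simp: limit_point_of_seq_def o_def)
    have ls: "(\<lambda>n. l (s n)) \<longlonglongrightarrow> fst q" and cs: "(\<lambda>n. c (s n)) \<longlonglongrightarrow> snd q"
      using tendsto_fst[OF s(2)] tendsto_snd[OF s(2)] by simp_all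
    have "c 0 \<le> snd q" using LIMSEQ_le_const[OF cs] c_ge by blast
    then have q_pos: "0 < snd q" using pos[of 0] by linarith
    have "dual_opt_value f G K Q \<le> \<theta>_star"
      unfolding dual_opt_value_def dual_domain_def using weak by (auto intro!: SUP_least)
    then have "dual_opt_value f G K Q - \<epsilon>_star \<le> \<theta>_star - \<epsilon>_star" by (intro ereal_minus_mono) auto
    also note T_liminf
    also have "liminf (\<lambda>n. dual_fun f G K Q (l n) (c n))
        \<le> liminf (\<lambda>n. dual_fun f G K Q (l (s n)) (c (s n)))"
      using liminf_subseq_mono[OF s(1), of "\<lambda>n. dual_fun f G K Q (l n) (c n)"] by (simp add: o_def)
    also have "\<dots> \<le> dual_fun f G K Q (fst q) (snd q)"
      by (rule dual_fun_upper_semicontinuous[OF K Kne ls cs q_pos assms(7)])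
    finally show ?thesis
      using q_pos by (cases q) (simp add: dual_eps_optimal_def dual_domain_def)
  qed

  show ?thesis
    using dist_lim \<phi>_limsup F_liminf F_limsup T_liminf T_limsup \<theta>_eq primal dual
    unfolding \<phi>_def by (simp add: Liminf_le_Limsup)
qed

end
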